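(* For any point $P$ not on the sides of $ABC$ or $K^{-1}(ABC)$, we have $\gamma_P(O)=H$.
   Context: We work in the Euclidean plane extended by its line at infinity $l_\infty$; affine maps are extended to $l_\infty$. $ABC$ is an ordinary non-degenerate triangle; its sides are the lines $BC, CA, AB$. $X_1X_2\cdot Y_1Y_2$ denotes the intersection of two lines. $K$ is the complement map (homothety with center the centroid $G$ and ratio $-1/2$); $K^{-1}(ABC)$ is the anticomplementary triangle. $\iota$ is the isotomic map, $(x:y:z)\mapsto(1/x:1/y:1/z)$ in barycentric coordinates. For $P$ (ordinary or infinite) not on the sides of $ABC$ or $K^{-1}(ABC)$ put $P'=\iota(P)$, $Q=K(P')$, and let $D=AP\cdot BC$, $E=BP\cdot CA$, $F=CP\cdot AB$. Let $D_0,E_0,F_0$ be the midpoints of $BC,CA,AB$. The generalized orthocenter $H$ of $P$ is the common point of the lines through $A,B,C$ parallel, respectively, to $QD,QE,QF$. The generalized circumcenter $O$ is the common point of the lines through $D_0,E_0,F_0$ parallel, respectively, to $QD,QE,QF$; so $O=K(H)$. (The line through $A$ parallel to a line $m$ means the line joining $A$ to $m\cdot l_\infty$; if $Q\in l_\infty$ then $H=O=Q$.) Generalized isogonal map $\gamma_P$: let $h_a$ be the affine reflection about the line $AQ$ in the direction of $EF$ (i.e. $h_a(X)=X'$ with $XX'\parallel EF$ and the midpoint of $XX'$ on $AQ$), $h_b$ the affine reflection about $BQ$ in the direction $DF$, and $h_c$ the affine reflection about $CQ$ in the direction $DE$. For $X\neq A,B,C$, $\gamma_P(X)$ is the common point of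 the lines $Ah_a(X),Bh_b(X),Ch_c(X)$ (which are concurrent). *)

theory Defs
  imports "HOL-Analysis.Analysis"
begin

section \<open>The extended plane\<close>

text \<open>
  The Euclidean plane together with its line at infinity, in homogeneous coordinates: a point is
  a one-dimensional subspace of \<open>real^2 \<times> real\<close>. The class of \<open>(x, 1)\<close> is the ordinary point \<open>x\<close>,
  and the class of \<open>(d, 0)\<close> with \<open>d \<noteq> 0\<close> is the infinite point in direction \<open>d\<close>.
\<close>

typedef ext_point = "{span {v} | v :: (real^2) \<times> real. v \<noteq> 0}"
  morphisms homog Abs_ext_point
proof
  show "span {(0, 1)} \<in> {span {v} | v :: (real^2) \<times> real. v \<noteq> 0}"
    by (rule CollectI, intro exI[of _ "(0, 1)"]) (simp add: zero_prod_def)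
qed

definition proj_point :: "(real^2) \<times> real \<Rightarrow> ext_point" where
  "proj_point v = Abs_ext_point (span {v})"

definition ordinary :: "real^2 \<Rightarrow> ext_point" where
  "ordinary x = proj_point (x, 1)"

definition line_at_infinity :: "ext_point set" where
  "line_at_infinity = {proj_point (d, 0) | d. d \<noteq> 0}"

text \<open>The line joining two distinct points, as a set of points; only meaningful for \<open>X \<noteq> Y\<close>.\<close>

definition line :: "ext_point \<Rightarrow> ext_point \<Rightarrow> ext_point set" where
  "line X Y = {Z. homog Z \<subseteq> span (homog X \<union> homog Y)}"

definition meet :: "ext_point set \<Rightarrow> ext_point set \<Rightarrow> ext_point" where
  "meet l m = (THE Z. Z \<in> l \<and> Z \<in> m)"

definition common_point ::
  "ext_point set \<Rightarrow> ext_point set \<Rightarrow> ext_point set \<Rightarrow> ext_point" where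
  "common_point l m n = (THE Z. Z \<in> l \<and> Z \<in> m \<and> Z \<in> n)"

definition parallel_through :: "ext_point \<Rightarrow> ext_point set \<Rightarrow> ext_point set" where
  "parallel_through X m = line X (meet m line_at_infinity)"

text \<open>
  Extension of a bijective affine map \<open>f\<close> to the line at infinity: \<open>f\<close> has linear part
  \<open>v \<mapsto> f v - f 0\<close>, so it acts on homogeneous coordinates by \<open>(v, t) \<mapsto> (f v - f 0 + t f 0, t)\<close>.
\<close>

definition extend :: "(real^2 \<Rightarrow> real^2) \<Rightarrow> ext_point \<Rightarrow> ext_point" where
  "extend f Z = Abs_ext_point ((\<lambda>(v, t). (f v - f 0 + t *\<^sub>R f 0, t)) ` homog Z)"

text \<open>
  The affine reflection about the line \<open>l\<close> in the direction of the line \<open>m\<close>. The condition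
  \<open>x x' \<parallel> m\<close> is stated so that it also covers \<open>x' = x\<close>, which occurs for \<open>x\<close> on \<open>l\<close>.
\<close>

definition affine_reflection ::
  "ext_point set \<Rightarrow> ext_point set \<Rightarrow> real^2 \<Rightarrow> real^2" where
  "affine_reflection l m x =
     (THE x'. ordinary x' \<in> parallel_through (ordinary x) m \<and> ordinary (midpoint x x') \<in> l)"

section \<open>Maps attached to a triangle\<close>

text \<open>
  The homogeneous barycentric coordinates \<open>(x : y : z)\<close>; infinite points are those with
  \<open>x + y + z = 0\<close>.
\<close>

definition barycentric ::
  "real^2 \<Rightarrow> real^2 \<Rightarrow> real^2 \<Rightarrow> real \<Rightarrow> real \<Rightarrow> real \<Rightarrow> ext_point" where
  "barycentric A B C x y z = proj_point (x *\<^sub>R (A, 1) + y *\<^sub>R (B, 1) + z *\<^sub>R (C, 1))"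

text \<open>The isotomic map, for points not on the sides of \<open>ABC\<close>.\<close>

definition isotomic :: "real^2 \<Rightarrow> real^2 \<Rightarrow> real^2 \<Rightarrow> ext_point \<Rightarrow> ext_point" where
  "isotomic A B C P =
     (THE R. \<exists>x y z. x \<noteq> 0 \<and> y \<noteq> 0 \<and> z \<noteq> 0 \<and>
        P = barycentric A B C x y z \<and> R = barycentric A B C (1 / x) (1 / y) (1 / z))"

definition homothety :: "real^2 \<Rightarrow> real \<Rightarrow> real^2 \<Rightarrow> real^2" where
  "homothety S k x = S + k *\<^sub>R (x - S)"

definition centroid :: "real^2 \<Rightarrow> real^2 \<Rightarrow> real^2 \<Rightarrow> real^2" where
  "centroid A B C = (1 / 3) *\<^sub>R (A + B + C)"

definition complement_map :: "real^2 \<Rightarrow> real^2 \<Rightarrow> real^2 \<Rightarrow> real^2 \<Rightarrow> real^2" where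
  "complement_map A B C = homothety (centroid A B C) (- 1 / 2)"

definition sides :: "real^2 \<Rightarrow> real^2 \<Rightarrow> real^2 \<Rightarrow> ext_point set" where
  "sides A B C = line (ordinary B) (ordinary C) \<union> line (ordinary C) (ordinary A)
     \<union> line (ordinary A) (ordinary B)"

definition anticomplementary_sides :: "real^2 \<Rightarrow> real^2 \<Rightarrow> real^2 \<Rightarrow> ext_point set" where
  "anticomplementary_sides A B C =
     (let K' = inv (complement_map A B C) in sides (K' A) (K' B) (K' C))"

section \<open>The generalized orthocenter, circumcenter and isogonal map\<close>

text \<open>\<open>Q = K (\<iota> P)\<close>\<close>

definition isotomcomplement :: "real^2 \<Rightarrow> real^2 \<Rightarrow> real^2 \<Rightarrow> ext_point \<Rightarrow> ext_point" where
  "isotomcomplement A B C P = extend (complement_map A B C) (isotomic A B C P)"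

text \<open>
  \<open>cevian_trace P A B C\<close> is \<open>AP \<cdot> BC\<close>, so the traces \<open>D\<close>, \<open>E\<close>, \<open>F\<close> of \<open>P\<close> are \<open>cevian_trace P A B C\<close>,
  \<open>cevian_trace P B C A\<close> and \<open>cevian_trace P C A B\<close>.
\<close>

definition cevian_trace :: "ext_point \<Rightarrow> real^2 \<Rightarrow> real^2 \<Rightarrow> real^2 \<Rightarrow> ext_point" where
  "cevian_trace P A B C = meet (line (ordinary A) P) (line (ordinary B) (ordinary C))"

definition gen_orthocenter :: "real^2 \<Rightarrow> real^2 \<Rightarrow> real^2 \<Rightarrow> ext_point \<Rightarrow> ext_point" where
  "gen_orthocenter A B C P =
    (let D = cevian_trace P A B C; E = cevian_trace P B C A;
         F = cevian_trace P C A B;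
         Q = isotomcomplement A B C P
     in common_point (parallel_through (ordinary A) (line Q D))
                     (parallel_through (ordinary B) (line Q E))
                     (parallel_through (ordinary C) (line Q F)))"

definition gen_circumcenter :: "real^2 \<Rightarrow> real^2 \<Rightarrow> real^2 \<Rightarrow> ext_point \<Rightarrow> ext_point" where
  "gen_circumcenter A B C P =
    (let D = cevian_trace P A B C; E = cevian_trace P B C A;
         F = cevian_trace P C A B;
         Q = isotomcomplement A B C P
     in common_point (parallel_through (ordinary (midpoint B C)) (line Q D))
                     (parallel_through (ordinary (midpoint C A)) (line Q E))
                     (parallel_through (ordinary (midpoint A B)) (line Q F)))"

text \<open>The map \<open>\<gamma>\<^sub>P\<close>, for points \<open>X\<close> other than \<open>A\<close>, \<open>B\<close>, \<open>C\<close>.\<close>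

definition gen_isogonal ::
  "real^2 \<Rightarrow> real^2 \<Rightarrow> real^2 \<Rightarrow> ext_point \<Rightarrow> ext_point \<Rightarrow> ext_point" where
  "gen_isogonal A B C P X =
    (let D = cevian_trace P A B C; E = cevian_trace P B C A;
         F = cevian_trace P C A B;
         Q = isotomcomplement A B C P;
         h\<^sub>a = extend (affine_reflection (line (ordinary A) Q) (line E F));
         h\<^sub>b = extend (affine_reflection (line (ordinary B) Q) (line D F));
         h\<^sub>c = extend (affine_reflection (line (ordinary C) Q) (line D E))
     in common_point (line (ordinary A) (h\<^sub>a X))
                     (line (ordinary B) (h\<^sub>b X))
                     (line (ordinary C) (h\<^sub>c X)))"

end

theory Submission
  imports Defs
begin

text \<open>
  In barycentric coordinates let \<open>P = (x : y : z)\<close> and put \<open>S = xy + yz + zx\<close>. The hypotheses say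
  exactly that \<open>x\<close>, \<open>y\<close>, \<open>z\<close> and the three sums \<open>y + z\<close>, \<open>z + x\<close>, \<open>x + y\<close> are nonzero. Then
  \<open>Q = (x(y + z) : y(z + x) : z(x + y))\<close>, which is also written \<open>(a : b : c)\<close> here, and the
  direction of \<open>QD\<close> is \<open>(x(y + z)\<^sup>2 : y(z\<^sup>2 - S) : z(y\<^sup>2 - S))\<close>. Intersecting the parallels through
  the midpoints of the sides gives
  \<open>O = (x(x\<^sup>2 - S)(y + z)\<^sup>2 : y(y\<^sup>2 - S)(z + x)\<^sup>2 : z(z\<^sup>2 - S)(x + y)\<^sup>2)\<close>
  (lemma \<open>gen_circumcenter_eq\<close>).

  The direction of \<open>EF\<close> is \<open>(b - c : -b : c)\<close>, harmonically conjugate to \<open>AQ\<close> with respect to \<open>AB\<close>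
  and \<open>AC\<close>; so \<open>h\<^sub>a\<close> fixes \<open>A\<close> and interchanges the lines \<open>AB\<close> and \<open>AC\<close>, and it moves the line
  joining \<open>A\<close> to \<open>(u : v : w)\<close> to the line on which the last two coordinates are in the ratio
  \<open>b\<^sup>2w : c\<^sup>2v\<close> (lemma \<open>line_vertex_reflected\<close>). For the coordinates of \<open>O\<close> all the squares cancel
  and the ratio becomes \<open>y(z\<^sup>2 - S) : z(y\<^sup>2 - S)\<close>, the one in the direction of \<open>QD\<close>. Thus the line
  \<open>A h\<^sub>a(O)\<close> is the parallel to \<open>QD\<close> through \<open>A\<close> (lemma \<open>line_reflected_circumcenter\<close>). By cyclic
  symmetry the three lines that define \<open>\<gamma>\<^sub>P(O)\<close> are the three lines that define \<open>H\<close>, and the two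
  points agree.

  Because lines are compared, only \<open>O\<close> has to be found as a common point of three lines, and for its
  uniqueness two of the bisectors must be different. This, like \<open>O \<noteq> A\<close>, rests on lemma
  \<open>not_both_right\<close>: at most one of \<open>x\<^sup>2\<close>, \<open>y\<^sup>2\<close>, \<open>z\<^sup>2\<close> equals \<open>S\<close>. The same formulas cover
  \<open>S = 0\<close>, the case in which \<open>Q\<close> is infinite.
\<close>

section \<open>Points and lines in homogeneous coordinates\<close>

lemma homog_proj_point:
  assumes "v \<noteq> 0"
  shows "homog (proj_point v) = span {v}"
  unfolding proj_point_def by (rule Abs_ext_point_inverse) (use assms in blast)

lemma proj_point_cases:
  obtains v where "v \<noteq> 0" "X = proj_point v"
proof -
  obtain v :: "(real^2) \<times> real" where v: "v \<noteq> 0" "homog X = span {v}"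
    using homog[of X] by auto
  then have "X = proj_point v"
    unfolding proj_point_def by (metis homog_inverse)
  with v show ?thesis using that by blast
qed

lemma proj_point_scale:
  assumes "k \<noteq> 0"
  shows "proj_point (k *\<^sub>R v) = proj_point v"
proof -
  have "span {k *\<^sub>R v} = span {v}"
    using span_image_scale[of "{v}" "\<lambda>_. k"] assms by simp
  then show ?thesis by (simp add: proj_point_def)
qed

lemma proj_point_eq_iff:
  assumes "v \<noteq> 0" "w \<noteq> 0"
  shows "proj_point v = proj_point w \<longleftrightarrow> (\<exists>k. v = k *\<^sub>R w)"
proof
  assume "proj_point v = proj_point w"
  then have "span {v} = span {w}"
    using assms homog_proj_point by metis
  then have "v \<in> span {w}"
    by (metis insertI1 span_base)
  then show "\<exists>k. v = k *\<^sub>R w"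
    by (auto simp: span_singleton)
next
  assume "\<exists>k. v = k *\<^sub>R w"
  then obtain k where k: "v = k *\<^sub>R w" by blast
  then have "k \<noteq> 0" using assms by (cases "k = 0") simp_all
  with k show "proj_point v = proj_point w"
    using proj_point_scale by metis
qed

lemma proj_point_in_line_iff:
  assumes "p \<noteq> 0" "v \<noteq> 0" "w \<noteq> 0"
  shows "proj_point p \<in> line (proj_point v) (proj_point w)
    \<longleftrightarrow> (\<exists>s t. p = s *\<^sub>R v + t *\<^sub>R w)"
proof -
  have "span (span {v} \<union> span {w}) = span {v, w}"
    using span_Un[of "span {v}" "span {w}"] span_Un[of "{v}" "{w}"]
    unfolding span_span insert_is_Un[of v "{w}"] by (rule trans[OF _ sym])
  moreover have "span {p} \<subseteq> span {v, w} \<longleftrightarrow> p \<in> span {v, w}"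
    using span_base[of p "{p}"] span_minimal[of "{p}" "span {v, w}"] subspace_span by auto
  moreover have "p \<in> span {v, w} \<longleftrightarrow> (\<exists>s t. p - s *\<^sub>R v = t *\<^sub>R w)"
    by (simp add: span_insert[of v "{w}"] span_singleton[of w] image_iff)
  ultimately show ?thesis
    using assms by (simp add: line_def homog_proj_point diff_eq_eq add.commute)
qed

lemma line_commute: "line X Y = line Y X"
  by (simp add: line_def Un_commute)

section \<open>Barycentric coordinates of points and lines\<close>

text \<open>
  The cyclic shift of the triangle carries every statement about the vertex \<open>A\<close> over to \<open>B\<close> and \<open>C\<close>,
  so that each computation below is made at one vertex only.
\<close>

lemma barycentric_cyclic: "barycentric B C A y z x = barycentric A B C x y z"
  by (simp add: barycentric_def algebra_simps)

lemma barycentric_scale: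
  assumes "k \<noteq> 0"
  shows "barycentric A B C (k * x) (k * y) (k * z) = barycentric A B C x y z"
proof -
  have "(k * x) *\<^sub>R (A, 1) + (k * y) *\<^sub>R (B, 1) + (k * z) *\<^sub>R (C, 1)
      = k *\<^sub>R (x *\<^sub>R (A, 1) + y *\<^sub>R (B, 1) + z *\<^sub>R (C, 1::real))"
    by (simp add: algebra_simps)
  then show ?thesis
    unfolding barycentric_def using proj_point_scale[OF assms] by metis
qed

lemma ordinary_eq_barycentric:
  assumes "u + v + w = 1"
  shows "ordinary (u *\<^sub>R A + v *\<^sub>R B + w *\<^sub>R C) = barycentric A B C u v w"
  using assms by (simp add: ordinary_def barycentric_def)

text \<open>Lines are encoded by the coefficients of their equation, so that joining points and intersecting
  lines are both cross products.\<close>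

definition bary_line ::
  "real^2 \<Rightarrow> real^2 \<Rightarrow> real^2 \<Rightarrow> real \<Rightarrow> real \<Rightarrow> real \<Rightarrow> ext_point set" where
  "bary_line A B C l m n =
    {barycentric A B C x y z | x y z. (x, y, z) \<noteq> (0, 0, 0) \<and> l * x + m * y + n * z = 0}"

lemma bary_line_rotate: "bary_line B C A m n l = bary_line A B C l m n"
proof -
  have "barycentric B C A y z x \<in> bary_line A B C l m n"
    if "(y, z, x) \<noteq> (0, 0, 0)" "m * y + n * z + l * x = 0" for x y z
    unfolding bary_line_def barycentric_cyclic[of B C A]
    using that by (intro CollectI exI[of _ x] exI[of _ y] exI[of _ z]) auto
  moreover have "barycentric A B C x y z \<in> bary_line B C A m n l"
    if "(x, y, z) \<noteq> (0, 0, 0)" "l * x + m * y + n * z = 0" for x y z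
    unfolding bary_line_def barycentric_cyclic[of B C A y z x, symmetric]
    using that by (intro CollectI exI[of _ y] exI[of _ z] exI[of _ x]) auto
  ultimately show ?thesis
    unfolding bary_line_def by blast
qed

lemma bary_line_cyclic: "bary_line B C A m n l = bary_line A B C l m n"
  "bary_line C A B n l m = bary_line A B C l m n"
  using bary_line_rotate by simp_all

locale triangle =
  fixes A B C :: "real^2"
  assumes not_collinear: "\<not> collinear {A, B, C}"
begin

lemma cyclic: "triangle B C A"
proof
  have "{B, C, A} = {A, B, C}" by auto
  then show "\<not> collinear {B, C, A}" using not_collinear by simp
qed

lemma dependent_imp_zero_snd:
  assumes "x *\<^sub>R A + y *\<^sub>R B + z *\<^sub>R C = 0" "x + y + z = 0"
  shows "y = 0"
proof (rule ccontr)
  assume y: "y \<noteq> 0"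
  have "y *\<^sub>R B = - (x *\<^sub>R A) - z *\<^sub>R C"
    using assms(1) by (simp add: algebra_simps eq_neg_iff_add_eq_0)
  then have "(1 / y) *\<^sub>R (y *\<^sub>R B) = (1 / y) *\<^sub>R (- (x *\<^sub>R A) - z *\<^sub>R C)" by simp
  then have "B = (- x / y) *\<^sub>R A + (- z / y) *\<^sub>R C"
    using y by (simp add: algebra_simps)
  moreover have "- z / y = 1 - - x / y"
    using assms(2) y by (simp add: field_simps)
  ultimately show False
    using not_collinear unfolding collinear_3_expand by metis
qed

text \<open>The vector of \<open>barycentric A B C x y z\<close>. The triangle is non-degenerate, so these vectors are the
  coordinate vectors of a basis of the three-dimensional space.\<close>

definition hvec :: "real \<Rightarrow> real \<Rightarrow> real \<Rightarrow> (real^2) \<times> real" where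
  "hvec x y z = x *\<^sub>R (A, 1) + y *\<^sub>R (B, 1) + z *\<^sub>R (C, 1)"

lemma barycentric_hvec: "barycentric A B C x y z = proj_point (hvec x y z)"
  by (simp add: barycentric_def hvec_def)

lemma hvec_diff: "hvec x y z - hvec x' y' z' = hvec (x - x') (y - y') (z - z')"
  by (simp add: hvec_def algebra_simps)

lemma hvec_comb:
  "s *\<^sub>R hvec x y z + t *\<^sub>R hvec x' y' z' = hvec (s * x + t * x') (s * y + t * y') (s * z + t * z')"
  by (simp add: hvec_def algebra_simps)

lemma hvec_scale: "s *\<^sub>R hvec x y z = hvec (s * x) (s * y) (s * z)"
  by (simp add: hvec_def algebra_simps)

lemma hvec_eq_0_iff: "hvec x y z = 0 \<longleftrightarrow> x = 0 \<and> y = 0 \<and> z = 0"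
proof
  assume "hvec x y z = 0"
  then have eq: "x *\<^sub>R A + y *\<^sub>R B + z *\<^sub>R C = 0" "x + y + z = 0"
    by (auto simp: hvec_def zero_prod_def)
  interpret BCA: triangle B C A by (rule cyclic)
  have "y = 0" by (rule dependent_imp_zero_snd[OF eq])
  moreover have "z = 0"
    by (rule BCA.dependent_imp_zero_snd[of y z x]) (use eq in \<open>simp_all add: algebra_simps\<close>)
  ultimately show "x = 0 \<and> y = 0 \<and> z = 0" using eq(2) by simp
qed (simp add: hvec_def zero_prod_def)

lemma hvec_eq_iff: "hvec x y z = hvec x' y' z' \<longleftrightarrow> x = x' \<and> y = y' \<and> z = z'"
  using hvec_eq_0_iff[of "x - x'" "y - y'" "z - z'"] hvec_diff[of x y z x' y' z']
  by (metis eq_iff_diff_eq_0)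

lemma hvec_surj: obtains x y z where "p = hvec x y z"
proof -
  define f where "f = (\<lambda>(x, y, z). hvec x y z)"
  have lin: "linear f"
    by (rule linearI) (auto simp: f_def hvec_def algebra_simps)
  have "inj f"
    by (auto simp: inj_def f_def hvec_eq_iff)
  then have "dim (range f) = dim (UNIV :: (real \<times> real \<times> real) set)"
    using dim_image_eq[OF lin, of UNIV] by simp
  then have "dim (range f) = DIM((real^2) \<times> real)"
    by simp
  then have "span (range f) = UNIV"
    using dim_eq_full by blast
  moreover have "span (range f) = range f"
    using lin by (metis span_linear_image span_UNIV)
  ultimately obtain q where "p = f q" by blast
  then show ?thesis using that by (cases q) (auto simp: f_def)
qed

lemma barycentric_cases:
  obtains x y z where "(x, y, z) \<noteq> (0, 0, 0)" "X = barycentric A B C x y z"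
proof -
  obtain p where p: "p \<noteq> 0" "X = proj_point p" by (rule proj_point_cases)
  obtain x y z where "p = hvec x y z" by (rule hvec_surj)
  with p show ?thesis using that hvec_eq_0_iff barycentric_hvec by auto
qed

lemma normalized_coordinates:
  obtains u v w where "u + v + w = 1" "x = u *\<^sub>R A + v *\<^sub>R B + w *\<^sub>R C"
proof -
  obtain u v w where "(x, 1) = hvec u v w" by (rule hvec_surj)
  then have "u + v + w = 1" "x = u *\<^sub>R A + v *\<^sub>R B + w *\<^sub>R C"
    by (simp_all add: hvec_def)
  then show ?thesis by (rule that)
qed

lemma barycentric_eqI:
  assumes "(x, y, z) \<noteq> (0, 0, 0)" "(p, q, r) \<noteq> (0, 0, 0)"
    and "x * q = y * p" "y * r = z * q" "z * p = x * r"
  shows "barycentric A B C x y z = barycentric A B C p q r"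
proof -
  obtain k where "x = k * p" "y = k * q" "z = k * r"
  proof (cases "p = 0")
    case p: False
    show thesis by (rule that[of "x / p"]) (use assms p in \<open>auto simp: field_simps\<close>)
  next
    case p: True
    show thesis
    proof (cases "q = 0")
      case q: False
      show thesis by (rule that[of "y / q"]) (use assms p q in \<open>auto simp: field_simps\<close>)
    next
      case q: True
      show thesis by (rule that[of "z / r"]) (use assms p q in \<open>auto simp: field_simps\<close>)
    qed
  qed
  then show ?thesis
    using assms(1) barycentric_scale[of k A B C p q r] by (cases "k = 0") auto
qed

lemma barycentric_eqD:
  assumes "(x, y, z) \<noteq> (0, 0, 0)" "(p, q, r) \<noteq> (0, 0, 0)"
    and "barycentric A B C x y z = barycentric A B C p q r"
  obtains k where "k \<noteq> 0" "x = k * p" "y = k * q" "z = k * r"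
proof -
  obtain k where "hvec x y z = k *\<^sub>R hvec p q r"
    using assms proj_point_eq_iff[of "hvec x y z" "hvec p q r"]
    by (auto simp: barycentric_hvec hvec_eq_0_iff)
  then have "x = k * p \<and> y = k * q \<and> z = k * r"
    by (simp add: hvec_scale hvec_eq_iff)
  then show ?thesis using that[of k] assms(1) by (cases "k = 0") auto
qed

lemma barycentric_in_bary_line_iff:
  assumes "(x, y, z) \<noteq> (0, 0, 0)"
  shows "barycentric A B C x y z \<in> bary_line A B C l m n \<longleftrightarrow> l * x + m * y + n * z = 0"
proof
  assume "barycentric A B C x y z \<in> bary_line A B C l m n"
  then obtain p q r where pqr: "(p, q, r) \<noteq> (0, 0, 0)" "l * p + m * q + n * r = 0"
    "barycentric A B C x y z = barycentric A B C p q r"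
    unfolding bary_line_def by auto
  obtain k where "x = k * p" "y = k * q" "z = k * r"
    using barycentric_eqD[OF assms pqr(1) pqr(3)] by blast
  then have "l * x + m * y + n * z = k * (l * p + m * q + n * r)"
    by (simp add: algebra_simps)
  with pqr(2) show "l * x + m * y + n * z = 0" by simp
next
  assume "l * x + m * y + n * z = 0"
  with assms show "barycentric A B C x y z \<in> bary_line A B C l m n"
    unfolding bary_line_def by blast
qed

lemma bary_line_scale:
  assumes "k \<noteq> 0" "l' = k * l" "m' = k * m" "n' = k * n"
  shows "bary_line A B C l' m' n' = bary_line A B C l m n"
proof -
  have "l' * x + m' * y + n' * z = k * (l * x + m * y + n * z)" for x y z
    using assms by (simp add: algebra_simps)
  with assms show ?thesis by (simp add: bary_line_def)
qed

text \<open>Cramer's rule: a vector orthogonal to the cross product of two vectors lies in their span. The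
  component that is divided by is the third one; the other cases follow by cyclic renaming.\<close>

lemma cramer:
  fixes x y z x' y' z' u v w :: real
  assumes "(y * z' - z * y') * u + (z * x' - x * z') * v + (x * y' - y * x') * w = 0"
    and n: "x * y' - y * x' \<noteq> 0"
  shows "\<exists>s t. u = s * x + t * x' \<and> v = s * y + t * y' \<and> w = s * z + t * z'"
proof -
  define d s t where "d = x * y' - y * x'" and "s = u * y' - v * x'" and "t = x * v - y * u"
  have d: "d \<noteq> 0" using n by (simp add: d_def)
  have "d * u = s * x + t * x'" "d * v = s * y + t * y'"
    by (simp_all add: d_def s_def t_def algebra_simps)
  moreover have "d * w = s * z + t * z'"
    using assms(1) by (simp add: d_def s_def t_def algebra_simps)
  ultimately have "u = s / d * x + t / d * x'" "v = s / d * y + t / d * y'"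
    "w = s / d * z + t / d * z'"
    using d by (simp_all add: nonzero_eq_divide_eq[symmetric] add_divide_distrib[symmetric]
        eq_divide_eq mult.commute)
  then show ?thesis by blast
qed

lemma line_barycentric_cross:
  assumes cross: "(y * z' - z * y', z * x' - x * z', x * y' - y * x') \<noteq> (0, 0, 0)"
  shows "line (barycentric A B C x y z) (barycentric A B C x' y' z')
    = bary_line A B C (y * z' - z * y') (z * x' - x * z') (x * y' - y * x')" (is "?l = ?m")
proof (rule set_eqI)
  fix Z
  have nz: "(x, y, z) \<noteq> (0, 0, 0)" "(x', y', z') \<noteq> (0, 0, 0)" using cross by auto
  obtain u v w where uvw: "(u, v, w) \<noteq> (0, 0, 0)" "Z = barycentric A B C u v w"
    by (rule barycentric_cases)
  have "Z \<in> ?l \<longleftrightarrow> (\<exists>s t. u = s * x + t * x' \<and> v = s * y + t * y' \<and> w = s * z + t * z')"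
    using proj_point_in_line_iff[of "hvec u v w" "hvec x y z" "hvec x' y' z'"] nz uvw
    by (simp add: barycentric_hvec hvec_eq_0_iff hvec_comb hvec_eq_iff)
  also have "\<dots> \<longleftrightarrow> (y * z' - z * y') * u + (z * x' - x * z') * v + (x * y' - y * x') * w = 0"
    (is "?L \<longleftrightarrow> ?R")
  proof
    assume ?L then show ?R by (auto simp: algebra_simps)
  next
    assume R: ?R
    from cross consider "x * y' - y * x' \<noteq> 0" | "y * z' - z * y' \<noteq> 0" | "z * x' - x * z' \<noteq> 0"
      by auto
    then show ?L
    proof cases
      case 1
      with R show ?thesis by (rule cramer)
    next
      case 2
      with R cramer[where x=y and y=z and z=x
          and x'=y' and y'=z' and z'=x' and u=v and v=w and w=u]
      show ?thesis by (auto simp: algebra_simps)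
    next
      case 3
      with R cramer[where x=z and y=x and z=y
          and x'=z' and y'=x' and z'=y' and u=w and v=u and w=v]
      show ?thesis by (auto simp: algebra_simps)
    qed
  qed
  also have "\<dots> \<longleftrightarrow> Z \<in> ?m"
    using uvw by (simp add: barycentric_in_bary_line_iff)
  finally show "Z \<in> ?l \<longleftrightarrow> Z \<in> ?m" .
qed

text \<open>The equation of a line is only determined up to a factor \<open>k\<close>, and cancelling it keeps the
  coefficients small.\<close>

lemma line_barycentric:
  assumes "(y * z' - z * y', z * x' - x * z', x * y' - y * x') \<noteq> (0, 0, 0)"
    and "k \<noteq> 0" "y * z' - z * y' = k * l" "z * x' - x * z' = k * m" "x * y' - y * x' = k * n"
  shows "line (barycentric A B C x y z) (barycentric A B C x' y' z') = bary_line A B C l m n"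
  using line_barycentric_cross[OF assms(1)] bary_line_scale[OF assms(2-5)] by simp

text \<open>Both coordinate triples of a common point and the cross product of the two equations solve the
  same linear system of rank two, so all of them are proportional.\<close>

lemma in_two_bary_lines_iff:
  assumes cross: "(m * n' - n * m', n * l' - l * n', l * m' - m * l') \<noteq> (0, 0, 0)"
    and pqr: "(p, q, r) \<noteq> (0, 0, 0)" "l * p + m * q + n * r = 0" "l' * p + m' * q + n' * r = 0"
  shows "Z \<in> bary_line A B C l m n \<and> Z \<in> bary_line A B C l' m' n' \<longleftrightarrow> Z = barycentric A B C p q r"
    (is "?L \<longleftrightarrow> ?R")
proof
  assume ?R
  with pqr show ?L by (simp add: barycentric_in_bary_line_iff)
next
  have crossed: "barycentric A B C x y z
      = barycentric A B C (m * n' - n * m') (n * l' - l * n') (l * m' - m * l')"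
    if nz: "(x, y, z) \<noteq> (0, 0, 0)"
      and e: "l * x + m * y + n * z = 0" "l' * x + m' * y + n' * z = 0" for x y z
  proof (rule barycentric_eqI[OF nz cross])
    have "x * (n * l' - l * n') - y * (m * n' - n * m')
        = n * (l' * x + m' * y + n' * z) - n' * (l * x + m * y + n * z)"
      by (simp add: algebra_simps)
    then show "x * (n * l' - l * n') = y * (m * n' - n * m')" using e by simp
    have "y * (l * m' - m * l') - z * (n * l' - l * n')
        = l * (l' * x + m' * y + n' * z) - l' * (l * x + m * y + n * z)"
      by (simp add: algebra_simps)
    then show "y * (l * m' - m * l') = z * (n * l' - l * n')" using e by simp
    have "z * (m * n' - n * m') - x * (l * m' - m * l')
        = m * (l' * x + m' * y + n' * z) - m' * (l * x + m * y + n * z)"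
      by (simp add: algebra_simps)
    then show "z * (m * n' - n * m') = x * (l * m' - m * l')" using e by simp
  qed
  assume L: ?L
  obtain u v w where uvw: "(u, v, w) \<noteq> (0, 0, 0)" "Z = barycentric A B C u v w"
    by (rule barycentric_cases)
  with L crossed[of u v w] crossed[of p q r] pqr show ?R
    by (simp add: barycentric_in_bary_line_iff)
qed

lemma meet_bary_line:
  assumes "(m * n' - n * m', n * l' - l * n', l * m' - m * l') \<noteq> (0, 0, 0)"
    and "(p, q, r) \<noteq> (0, 0, 0)" "l * p + m * q + n * r = 0" "l' * p + m' * q + n' * r = 0"
  shows "meet (bary_line A B C l m n) (bary_line A B C l' m' n') = barycentric A B C p q r"
  unfolding meet_def in_two_bary_lines_iff[OF assms] by simp

lemma ordinary_vertex: "ordinary A = barycentric A B C 1 0 0"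
  "ordinary B = barycentric A B C 0 1 0" "ordinary C = barycentric A B C 0 0 1"
  by (simp_all add: ordinary_def barycentric_def)

lemma ordinary_midpoint: "ordinary (midpoint B C) = barycentric A B C 0 1 1"
proof -
  have "ordinary (midpoint B C) = barycentric A B C 0 (1/2) (1/2)"
    using ordinary_eq_barycentric[of 0 "1/2" "1/2" A B C]
    by (simp add: midpoint_def algebra_simps)
  then show ?thesis using barycentric_scale[of "1/2" A B C 0 1 1] by simp
qed

lemma line_at_infinity_eq: "line_at_infinity = bary_line A B C 1 1 1"
proof (rule set_eqI)
  fix Z
  obtain u v w where uvw: "(u, v, w) \<noteq> (0, 0, 0)" "Z = barycentric A B C u v w"
    by (rule barycentric_cases)
  have nz: "hvec u v w \<noteq> 0" using uvw hvec_eq_0_iff by auto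
  have snd: "snd (hvec u v w) = u + v + w" by (simp add: hvec_def)
  have "Z \<in> line_at_infinity \<longleftrightarrow> snd (hvec u v w) = 0"
  proof
    assume "Z \<in> line_at_infinity"
    then obtain d :: "real^2" where d: "d \<noteq> 0" "proj_point (hvec u v w) = proj_point (d, 0)"
      using uvw(2) by (auto simp: line_at_infinity_def barycentric_hvec)
    then show "snd (hvec u v w) = 0"
      using nz proj_point_eq_iff[of "hvec u v w" "(d, 0)"] by (auto simp: zero_prod_def)
  next
    assume "snd (hvec u v w) = 0"
    then obtain d where d: "hvec u v w = (d, 0)" by (metis prod.collapse)
    with nz have "d \<noteq> 0" by (auto simp: zero_prod_def)
    with d uvw(2) show "Z \<in> line_at_infinity"
      by (auto simp: line_at_infinity_def barycentric_hvec)
  qed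
  then show "Z \<in> line_at_infinity \<longleftrightarrow> Z \<in> bary_line A B C 1 1 1"
    using uvw snd by (simp add: barycentric_in_bary_line_iff)
qed

text \<open>
  An affine map is determined by the images of the vertices, and its extension keeps the
  barycentric coordinates while it replaces the vertices by their images. The linear map in the
  definition of \<open>extend\<close> involves \<open>f 0\<close>, so the proof writes the origin in normalized coordinates.
\<close>

lemma extend_barycentric:
  assumes f: "\<And>u v w. u + v + w = 1 \<Longrightarrow>
      f (u *\<^sub>R A + v *\<^sub>R B + w *\<^sub>R C) = u *\<^sub>R A' + v *\<^sub>R B' + w *\<^sub>R C'"
    and nz: "(u, v, w) \<noteq> (0, 0, 0)"
  shows "extend f (barycentric A B C u v w) = barycentric A' B' C' u v w"
proof -
  define g where "g = (\<lambda>(p, t). (f p - f 0 + t *\<^sub>R f 0, t :: real))"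
  have g: "g (hvec x y z) = x *\<^sub>R (A', 1) + y *\<^sub>R (B', 1) + z *\<^sub>R (C', 1)" for x y z
  proof -
    obtain a b c where abc: "a + b + c = 1" and zero: "a *\<^sub>R A + b *\<^sub>R B + c *\<^sub>R C = 0"
      by (metis normalized_coordinates)
    define t where "t = x + y + z"
    define p where "p = x *\<^sub>R A + y *\<^sub>R B + z *\<^sub>R C"
    have hv: "hvec x y z = (p, t)" by (simp add: hvec_def p_def t_def)
    have "p = p + (1 - t) *\<^sub>R (a *\<^sub>R A + b *\<^sub>R B + c *\<^sub>R C)" using zero by simp
    also have "\<dots> = (x + (1 - t) * a) *\<^sub>R A + (y + (1 - t) * b) *\<^sub>R B + (z + (1 - t) * c) *\<^sub>R C"
      by (simp add: p_def algebra_simps)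
    finally have p: "p = (x + (1 - t) * a) *\<^sub>R A + (y + (1 - t) * b) *\<^sub>R B + (z + (1 - t) * c) *\<^sub>R C" .
    have "(x + (1 - t) * a) + (y + (1 - t) * b) + (z + (1 - t) * c) = t + (1 - t) * (a + b + c)"
      by (simp add: t_def algebra_simps)
    then have "f p = (x + (1 - t) * a) *\<^sub>R A' + (y + (1 - t) * b) *\<^sub>R B' + (z + (1 - t) * c) *\<^sub>R C'"
      unfolding p by (intro f) (simp add: abc)
    moreover have "f 0 = a *\<^sub>R A' + b *\<^sub>R B' + c *\<^sub>R C'"
      using f[OF abc] zero by simp
    ultimately have "f p - f 0 + t *\<^sub>R f 0 = x *\<^sub>R A' + y *\<^sub>R B' + z *\<^sub>R C'"
      by (simp add: algebra_simps)
    then show ?thesis by (simp add: g_def hv t_def)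
  qed
  have "g ` span {hvec u v w} = span {g (hvec u v w)}"
  proof -
    have "g (k *\<^sub>R hvec u v w) = k *\<^sub>R g (hvec u v w)" for k
      by (simp add: hvec_scale g algebra_simps)
    then show ?thesis by (simp add: span_singleton image_image)
  qed
  then show ?thesis
    using nz by (simp add: extend_def barycentric_hvec homog_proj_point hvec_eq_0_iff)
      (simp add: g g_def[symmetric] barycentric_def proj_point_def)
qed


section \<open>The sides, the complement map and the isotomic map\<close>

lemma line_vertices: "line (ordinary B) (ordinary C) = bary_line A B C 1 0 0"
  "line (ordinary C) (ordinary A) = bary_line A B C 0 1 0"
  "line (ordinary A) (ordinary B) = bary_line A B C 0 0 1"
  unfolding ordinary_vertex by (rule line_barycentric[where k = 1]; simp)+

lemma line_vertex:
  assumes "(y, z) \<noteq> (0, 0)"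
  shows "line (ordinary A) (barycentric A B C x y z) = bary_line A B C 0 z (- y)"
  unfolding ordinary_vertex by (rule line_barycentric[where k = "-1"]) (use assms in auto)

lemma complement_map_eq:
  "complement_map A B C X = (1/2) *\<^sub>R (A + B + C) - (1/2) *\<^sub>R X"
  by (simp add: complement_map_def homothety_def centroid_def vec_eq_iff field_simps)

lemma inv_complement_map:
  "inv (complement_map A B C) = (\<lambda>X. A + B + C - 2 *\<^sub>R X)"
  by (rule inv_equality) (simp_all add: complement_map_eq vec_eq_iff field_simps)

text \<open>The vertices of the anticomplementary triangle are \<open>(-1 : 1 : 1)\<close>, \<open>(1 : -1 : 1)\<close> and
  \<open>(1 : 1 : -1)\<close>; the last two span the line \<open>y + z = 0\<close>.\<close>

lemma anticomplementary_side:
  assumes "(x, y, z) \<noteq> (0, 0, 0)" "y + z = 0"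
  shows "barycentric A B C x y z \<in> anticomplementary_sides A B C"
proof -
  let ?K = "inv (complement_map A B C)"
  have B: "ordinary (?K B) = barycentric A B C 1 (-1) 1"
    using ordinary_eq_barycentric[of 1 "-1" 1 A B C]
    by (simp add: inv_complement_map scaleR_2 algebra_simps)
  have C: "ordinary (?K C) = barycentric A B C 1 1 (-1)"
    using ordinary_eq_barycentric[of 1 1 "-1" A B C]
    by (simp add: inv_complement_map scaleR_2 algebra_simps)
  have "line (ordinary (?K B)) (ordinary (?K C)) = bary_line A B C 0 1 1"
    unfolding B C by (rule line_barycentric[where k = 2]) simp_all
  then show ?thesis
    using assms by (simp add: anticomplementary_sides_def sides_def Let_def barycentric_in_bary_line_iff)
qed

lemma extend_complement_map:
  assumes "(u, v, w) \<noteq> (0, 0, 0)"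
  shows "extend (complement_map A B C) (barycentric A B C u v w)
    = barycentric A B C (v + w) (w + u) (u + v)"
proof -
  have "extend (complement_map A B C) (barycentric A B C u v w)
      = barycentric ((1/2) *\<^sub>R (B + C)) ((1/2) *\<^sub>R (C + A)) ((1/2) *\<^sub>R (A + B)) u v w"
  proof (rule extend_barycentric[OF _ assms])
    fix u v w :: real
    assume "u + v + w = 1"
    then have w: "w = 1 - u - v" by simp
    show "complement_map A B C (u *\<^sub>R A + v *\<^sub>R B + w *\<^sub>R C)
        = u *\<^sub>R ((1/2) *\<^sub>R (B + C)) + v *\<^sub>R ((1/2) *\<^sub>R (C + A)) + w *\<^sub>R ((1/2) *\<^sub>R (A + B))"
      unfolding complement_map_eq w by (simp add: vec_eq_iff field_simps)
  qed
  also have "\<dots> = barycentric A B C (1/2 * (v + w)) (1/2 * (w + u)) (1/2 * (u + v))"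
    by (simp add: barycentric_def algebra_simps add_divide_distrib)
  also have "\<dots> = barycentric A B C (v + w) (w + u) (u + v)"
    by (rule barycentric_scale) simp
  finally show ?thesis .
qed

text \<open>The reciprocals are cleared of denominators, so that the coordinates of \<open>Q\<close> are polynomials.\<close>

lemma isotomic_barycentric:
  assumes "x \<noteq> 0" "y \<noteq> 0" "z \<noteq> 0"
  shows "isotomic A B C (barycentric A B C x y z) = barycentric A B C (y * z) (z * x) (x * y)"
  unfolding isotomic_def
proof (rule the_equality)
  have "barycentric A B C (y * z) (z * x) (x * y) = barycentric A B C (1 / x) (1 / y) (1 / z)"
    by (rule barycentric_eqI) (use assms in auto)
  with assms show "\<exists>x' y' z'. x' \<noteq> 0 \<and> y' \<noteq> 0 \<and> z' \<noteq> 0 \<and>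
      barycentric A B C x y z = barycentric A B C x' y' z' \<and>
      barycentric A B C (y * z) (z * x) (x * y) = barycentric A B C (1 / x') (1 / y') (1 / z')"
    by blast
next
  fix R
  assume "\<exists>x' y' z'. x' \<noteq> 0 \<and> y' \<noteq> 0 \<and> z' \<noteq> 0 \<and>
      barycentric A B C x y z = barycentric A B C x' y' z' \<and>
      R = barycentric A B C (1 / x') (1 / y') (1 / z')"
  then obtain x' y' z' where nz: "x' \<noteq> 0" "y' \<noteq> 0" "z' \<noteq> 0"
    and eq: "barycentric A B C x y z = barycentric A B C x' y' z'"
    and R: "R = barycentric A B C (1 / x') (1 / y') (1 / z')" by blast
  obtain k where k: "k \<noteq> 0" "x = k * x'" "y = k * y'" "z = k * z'"
    using barycentric_eqD[OF _ _ eq] assms nz by auto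
  show "R = barycentric A B C (y * z) (z * x) (x * y)"
    unfolding R by (rule barycentric_eqI) (use assms nz k in auto)
qed

section \<open>The affine reflection at a vertex\<close>

text \<open>
  With \<open>A\<close> as origin, the axis has direction \<open>b(B - A) + c(C - A)\<close> and the reflection reverses
  \<open>-b(B - A) + c(C - A)\<close>. Hence it interchanges \<open>b(B - A)\<close> with \<open>c(C - A)\<close>, and the images of \<open>B\<close>
  and \<open>C\<close> are the points that multiply \<open>v\<close> and \<open>w\<close> on the right. The proof turns the two defining
  conditions on the image into linear equations and solves them.
\<close>

lemma affine_reflection_coordinates:
  assumes nz: "b \<noteq> 0" "c \<noteq> 0"
    and dir: "meet m line_at_infinity = barycentric A B C (b - c) (- b) c"
    and sum: "u + v + w = 1"
  shows "affine_reflection (bary_line A B C 0 c (- b)) m (u *\<^sub>R A + v *\<^sub>R B + w *\<^sub>R C)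
    = u *\<^sub>R A + v *\<^sub>R (A + (c / b) *\<^sub>R (C - A)) + w *\<^sub>R (A + (b / c) *\<^sub>R (B - A))"
    (is "affine_reflection ?l m ?X = ?X'")
proof -
  define s where "s = v * c + w * b"
  have u: "u = 1 - v - w" using sum by simp
  have X: "ordinary ?X = barycentric A B C u v w"
    by (rule ordinary_eq_barycentric[OF sum])
  have par: "parallel_through (ordinary ?X) m = bary_line A B C s (s - c) (s - b)"
    unfolding parallel_through_def dir X
    by (rule line_barycentric[where k = 1]) (use nz in \<open>auto simp: s_def u algebra_simps\<close>)
  (* The first condition says that c v + b w is constant, the second that c v - b w changes sign. *)
  have iff: "(ordinary Y \<in> parallel_through (ordinary ?X) m \<and> ordinary (midpoint ?X Y) \<in> ?l)
      \<longleftrightarrow> v' = w * (b / c) \<and> w' = v * (c / b)"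
    if sum': "u' + v' + w' = 1" and Y: "Y = u' *\<^sub>R A + v' *\<^sub>R B + w' *\<^sub>R C" for Y u' v' w'
  proof -
    have u': "u' = 1 - v' - w'" using sum' by simp
    have nz': "(u', v', w') \<noteq> (0, 0, 0)" using sum' by auto
    have "midpoint ?X Y = ((u + u') / 2) *\<^sub>R A + ((v + v') / 2) *\<^sub>R B + ((w + w') / 2) *\<^sub>R C"
      by (simp add: midpoint_def Y vec_eq_iff field_simps)
    then have M: "ordinary (midpoint ?X Y)
        = barycentric A B C ((u + u') / 2) ((v + v') / 2) ((w + w') / 2)"
      using sum sum' by (simp add: ordinary_eq_barycentric add_divide_distrib[symmetric])
    have nzM: "((u + u') / 2, (v + v') / 2, (w + w') / 2) \<noteq> (0, 0, 0)"
      using sum sum' by auto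
    have "ordinary Y \<in> parallel_through (ordinary ?X) m \<longleftrightarrow> c * v' + b * w' = s"
      unfolding par Y ordinary_eq_barycentric[OF sum'] barycentric_in_bary_line_iff[OF nz']
      by (auto simp: u' algebra_simps)
    moreover have "ordinary (midpoint ?X Y) \<in> ?l \<longleftrightarrow> c * v' - b * w' = b * w - c * v"
      unfolding M barycentric_in_bary_line_iff[OF nzM] by (auto simp: field_simps)
    moreover have "c * v' + b * w' = s \<and> c * v' - b * w' = b * w - c * v
        \<longleftrightarrow> c * v' = b * w \<and> b * w' = c * v"
      unfolding s_def by (auto simp: algebra_simps)
    moreover have "c * v' = b * w \<and> b * w' = c * v \<longleftrightarrow> v' = w * (b / c) \<and> w' = v * (c / b)"
      using nz by (auto simp: field_simps)
    ultimately show ?thesis by blast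
  qed
  have X': "?X' = (1 - w * (b / c) - v * (c / b)) *\<^sub>R A + (w * (b / c)) *\<^sub>R B + (v * (c / b)) *\<^sub>R C"
    unfolding u by (simp add: algebra_simps)
  show ?thesis
    unfolding affine_reflection_def
  proof (rule the_equality)
    show "ordinary ?X' \<in> parallel_through (ordinary ?X) m \<and> ordinary (midpoint ?X ?X') \<in> ?l"
      by (subst iff[OF _ X']) simp_all
  next
    fix Y
    assume Y: "ordinary Y \<in> parallel_through (ordinary ?X) m \<and> ordinary (midpoint ?X Y) \<in> ?l"
    obtain u' v' w' where n: "u' + v' + w' = 1" "Y = u' *\<^sub>R A + v' *\<^sub>R B + w' *\<^sub>R C"
      by (rule normalized_coordinates)
    have "v' = w * (b / c)" "w' = v * (c / b)" using Y iff[OF n] by blast+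
    moreover from this n(1) have "u' = 1 - w * (b / c) - v * (c / b)" by simp
    ultimately show "Y = ?X'" using n(2) X' by simp
  qed
qed

text \<open>
  The reflected line depends on the point only through \<open>v : w\<close>, and the coefficients show the analogue
  of the isogonal map, \<open>(u : v : w) \<mapsto> (a\<^sup>2/u : b\<^sup>2/v : c\<^sup>2/w)\<close>, without dividing by coordinates that
  may vanish. The condition on \<open>v\<close> and \<open>w\<close> excludes the point \<open>A\<close>.
\<close>

lemma line_vertex_reflected:
  assumes nz: "b \<noteq> 0" "c \<noteq> 0"
    and dir: "meet m line_at_infinity = barycentric A B C (b - c) (- b) c"
    and vw: "(v, w) \<noteq> (0, 0)"
  shows "line (ordinary A)
      (extend (affine_reflection (bary_line A B C 0 c (- b)) m) (barycentric A B C u v w))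
    = bary_line A B C 0 (c\<^sup>2 * v) (- (b\<^sup>2 * w))"
proof -
  let ?h = "affine_reflection (bary_line A B C 0 c (- b)) m"
  have "extend ?h (barycentric A B C u v w)
      = barycentric A (A + (c / b) *\<^sub>R (C - A)) (A + (b / c) *\<^sub>R (B - A)) u v w"
    by (rule extend_barycentric[OF affine_reflection_coordinates[OF nz dir]]) (use vw in auto)
  also have "\<dots> = barycentric A B C
      (u + v * (1 - c / b) + w * (1 - b / c)) (w * (b / c)) (v * (c / b))"
    by (simp add: barycentric_def algebra_simps)
  finally have *: "extend ?h (barycentric A B C u v w) = \<dots>" .
  have "line (ordinary A) (extend ?h (barycentric A B C u v w))
      = bary_line A B C 0 (v * (c / b)) (- (w * (b / c)))"
    unfolding * by (rule line_vertex) (use nz vw in auto)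
  also have "\<dots> = bary_line A B C 0 (c\<^sup>2 * v) (- (b\<^sup>2 * w))"
    by (rule bary_line_scale[where k = "1 / (b * c)"])
      (use nz in \<open>auto simp: field_simps power2_eq_square\<close>)
  finally show ?thesis .
qed

end

section \<open>The generalized orthocenter and circumcenter\<close>

locale triangle_point = triangle +
  fixes x y z :: real
  assumes nonzero: "x \<noteq> 0" "y \<noteq> 0" "z \<noteq> 0"
    and sum_nonzero: "y + z \<noteq> 0" "z + x \<noteq> 0" "x + y \<noteq> 0"
begin

lemma cyclic_point: "triangle_point B C A y z x"
  using cyclic nonzero sum_nonzero
  by (simp add: triangle_point_def triangle_point_axioms_def)

abbreviation P :: ext_point where "P \<equiv> barycentric A B C x y z"

abbreviation S :: real where "S \<equiv> x * y + y * z + z * x"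

lemma P_cyclic: "barycentric B C A y z x = P" "barycentric C A B z x y = P"
  by (simp_all add: barycentric_def algebra_simps)

text \<open>
  If \<open>y\<^sup>2 = S\<close>, then the parallel to \<open>QD\<close> through \<open>A\<close> is \<open>AB\<close> and \<open>H = B\<close>: the triangle has a
  generalized right angle at \<open>B\<close>. The lemma says that there is at most one right angle.
\<close>

lemma not_both_right: "\<not> (y\<^sup>2 = S \<and> z\<^sup>2 = S)"
proof
  assume "y\<^sup>2 = S \<and> z\<^sup>2 = S"
  then have yz: "y\<^sup>2 = S" "z\<^sup>2 = S" by auto
  then have "(y + z) * (y - z) = 0" by (simp add: algebra_simps power2_eq_square)
  then have "y = z" using sum_nonzero by simp
  with yz have "x * y = 0" by (simp add: algebra_simps power2_eq_square)
  then show False using nonzero by simp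
qed

lemma trace: "cevian_trace P A B C = barycentric A B C 0 y z"
proof -
  have "line (ordinary A) P = bary_line A B C 0 z (- y)"
    by (rule line_vertex) (use nonzero in simp)
  then show ?thesis
    unfolding cevian_trace_def line_vertices
    by (simp only:) (rule meet_bary_line; use nonzero in simp)
qed

lemma isotomcomplement_eq:
  "isotomcomplement A B C P = barycentric A B C (x * (y + z)) (y * (z + x)) (z * (x + y))"
  unfolding isotomcomplement_def isotomic_barycentric[OF nonzero]
  by (subst extend_complement_map) (use nonzero in \<open>auto simp: algebra_simps\<close>)

lemma direction_trace:
  "meet (line (isotomcomplement A B C P) (cevian_trace P A B C)) line_at_infinity
    = barycentric A B C (x * (y + z)\<^sup>2) (y * (z\<^sup>2 - S)) (z * (y\<^sup>2 - S))"
proof -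
  have "line (isotomcomplement A B C P) (cevian_trace P A B C)
      = bary_line A B C (y * z * (z - y)) (- (x * (y + z) * z)) (x * (y + z) * y)"
    unfolding isotomcomplement_eq trace
    by (rule line_barycentric[where k = 1]) (use nonzero sum_nonzero in \<open>auto simp: algebra_simps\<close>)
  (* a component of the cross product with the line at infinity *)
  moreover have "- (x * (y + z) * z) * 1 - x * (y + z) * y * 1 \<noteq> 0"
  proof -
    have "- (x * (y + z) * z) * 1 - x * (y + z) * y * 1 = - (x * (y + z)\<^sup>2)"
      by (simp add: algebra_simps power2_eq_square)
    then show ?thesis using nonzero sum_nonzero by simp
  qed
  ultimately show ?thesis
    unfolding line_at_infinity_eq
    using nonzero sum_nonzero
    by (simp only:) (rule meet_bary_line, simp, simp, simp_all add: algebra_simps power2_eq_square)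
qed

lemma altitude:
  "parallel_through (ordinary A) (line (isotomcomplement A B C P) (cevian_trace P A B C))
    = bary_line A B C 0 (z * (y\<^sup>2 - S)) (- (y * (z\<^sup>2 - S)))"
  unfolding parallel_through_def direction_trace
  by (rule line_vertex) (use nonzero not_both_right in auto)

lemma bisector:
  "parallel_through (ordinary (midpoint B C))
      (line (isotomcomplement A B C P) (cevian_trace P A B C))
    = bary_line A B C (z * (y\<^sup>2 - S) - y * (z\<^sup>2 - S)) (x * (y + z)\<^sup>2) (- (x * (y + z)\<^sup>2))"
  unfolding parallel_through_def direction_trace ordinary_midpoint
  by (rule line_barycentric[where k = 1]) (use nonzero sum_nonzero in auto)

text \<open>In terms of \<open>Q = (a : b : c)\<close> the direction of \<open>EF\<close> is \<open>(b - c : -b : c)\<close>, the form that makes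
  the reflection about \<open>AQ\<close> interchange the lines \<open>AB\<close> and \<open>AC\<close>.\<close>

lemma direction_traces:
  "meet (line (cevian_trace P B C A) (cevian_trace P C A B)) line_at_infinity
    = barycentric A B C (y * (z + x) - z * (x + y)) (- (y * (z + x))) (z * (x + y))"
proof -
  interpret BCA: triangle_point B C A y z x by (rule cyclic_point)
  interpret CAB: triangle_point C A B z x y by (rule BCA.cyclic_point)
  have E: "cevian_trace P B C A = barycentric A B C x 0 z"
    using BCA.trace by (simp add: barycentric_cyclic P_cyclic)
  have F: "cevian_trace P C A B = barycentric A B C x y 0"
    using CAB.trace by (simp add: barycentric_cyclic P_cyclic)
  have "line (cevian_trace P B C A) (cevian_trace P C A B)
      = bary_line A B C (- (y * z)) (z * x) (x * y)"
    unfolding E F by (rule line_barycentric[where k = 1]) (use nonzero in auto)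
  (* a component of the cross product with the line at infinity *)
  moreover have "x * y + y * z \<noteq> 0"
  proof -
    have "x * y + y * z = y * (z + x)" by (simp add: algebra_simps)
    then show ?thesis using nonzero sum_nonzero by simp
  qed
  ultimately show ?thesis
    unfolding line_at_infinity_eq
    by (simp only:) (rule meet_bary_line; use nonzero sum_nonzero in \<open>auto simp: algebra_simps\<close>)
qed

text \<open>These are the coordinates \<open>(q + r : r + p : p + q)\<close> of the complement of
  \<open>H = (p : q : r)\<close>, where \<open>p = x(y\<^sup>2 - S)(z\<^sup>2 - S)\<close> and \<open>q\<close>, \<open>r\<close> are its cyclic shifts, after a
  common factor is removed.\<close>

abbreviation circumcenter :: ext_point where
  "circumcenter \<equiv> barycentric A B C
    (x * (x\<^sup>2 - S) * (y + z)\<^sup>2) (y * (y\<^sup>2 - S) * (z + x)\<^sup>2) (z * (z\<^sup>2 - S) * (x + y)\<^sup>2)"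

text \<open>Multiplying \<open>v\<close> by \<open>c\<^sup>2 = z\<^sup>2(x + y)\<^sup>2\<close> and \<open>w\<close> by \<open>b\<^sup>2 = y\<^sup>2(z + x)\<^sup>2\<close> supplies to each of the
  coordinates of \<open>O\<close> the squared factor that the other one has, so it drops out of the ratio. By
  lemma \<open>not_both_right\<close>, \<open>v\<close> and \<open>w\<close> do not both vanish.\<close>

lemma line_reflected_circumcenter:
  "line (ordinary A)
      (extend
        (affine_reflection (line (ordinary A) (isotomcomplement A B C P))
          (line (cevian_trace P B C A) (cevian_trace P C A B)))
        circumcenter)
    = parallel_through (ordinary A) (line (isotomcomplement A B C P) (cevian_trace P A B C))"
proof -
  let ?b = "y * (z + x)" and ?c = "z * (x + y)"
  have bc: "?b \<noteq> 0" "?c \<noteq> 0" using nonzero sum_nonzero by auto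
  have "line (ordinary A) (isotomcomplement A B C P) = bary_line A B C 0 ?c (- ?b)"
    unfolding isotomcomplement_eq by (rule line_vertex) (use bc in simp)
  then have "line (ordinary A)
      (extend
        (affine_reflection (line (ordinary A) (isotomcomplement A B C P))
          (line (cevian_trace P B C A) (cevian_trace P C A B)))
        circumcenter)
    = bary_line A B C 0 (?c\<^sup>2 * (y * (y\<^sup>2 - S) * (z + x)\<^sup>2)) (- (?b\<^sup>2 * (z * (z\<^sup>2 - S) * (x + y)\<^sup>2)))"
    by (simp only:) (rule line_vertex_reflected[OF bc direction_traces];
        use nonzero sum_nonzero not_both_right in auto)
  also have "\<dots> = bary_line A B C 0 (z * (y\<^sup>2 - S)) (- (y * (z\<^sup>2 - S)))"
    by (rule bary_line_scale[where k = "y * z * (z + x)\<^sup>2 * (x + y)\<^sup>2"])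
      (use nonzero sum_nonzero in \<open>auto simp: power2_eq_square\<close>)
  finally show ?thesis unfolding altitude .
qed

lemma isotomcomplement_cyclic:
  "isotomcomplement B C A P = isotomcomplement A B C P"
  "isotomcomplement C A B P = isotomcomplement A B C P"
proof -
  interpret BCA: triangle_point B C A y z x by (rule cyclic_point)
  interpret CAB: triangle_point C A B z x y by (rule BCA.cyclic_point)
  show "isotomcomplement B C A P = isotomcomplement A B C P"
    using BCA.isotomcomplement_eq unfolding P_cyclic isotomcomplement_eq
    by (simp only: barycentric_cyclic[of B C A "y * (z + x)"])
  show "isotomcomplement C A B P = isotomcomplement A B C P"
    using CAB.isotomcomplement_eq unfolding P_cyclic isotomcomplement_eq
    by (simp only: barycentric_cyclic[of C A B "z * (x + y)"] barycentric_cyclic[of B C A "y * (z + x)"])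
qed

text \<open>
  That \<open>O\<close> lies on the three bisectors is a polynomial identity. The bisectors of \<open>BC\<close> and \<open>CA\<close>
  coincide only if both are the midline parallel to \<open>AB\<close>, which forces \<open>x\<^sup>2 = S\<close> and \<open>y\<^sup>2 = S\<close>.
\<close>

lemma gen_circumcenter_eq: "gen_circumcenter A B C P = circumcenter"
proof -
  interpret BCA: triangle_point B C A y z x by (rule cyclic_point)
  interpret CAB: triangle_point C A B z x y by (rule BCA.cyclic_point)
  let ?X = "x * (y + z)\<^sup>2" and ?Y = "y * (z + x)\<^sup>2" and ?Z = "z * (x + y)\<^sup>2"
  let ?a = "z * (y\<^sup>2 - S) - y * (z\<^sup>2 - S)" and ?b = "x * (z\<^sup>2 - S) - z * (x\<^sup>2 - S)"
    and ?c = "y * (x\<^sup>2 - S) - x * (y\<^sup>2 - S)"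
  have S: "BCA.S = S" "CAB.S = S" by simp_all
  note b = BCA.bisector[unfolded P_cyclic isotomcomplement_cyclic
      bary_line_cyclic(1)[of B C A] bary_line_cyclic(2)[of C A B] S]
  note c = CAB.bisector[unfolded P_cyclic isotomcomplement_cyclic
      bary_line_cyclic(1)[of B C A] bary_line_cyclic(2)[of C A B] S]
  let ?A = "bary_line A B C ?a ?X (- ?X)" and ?B = "bary_line A B C (- ?Y) ?b ?Y"
    and ?C = "bary_line A B C ?Z (- ?Z) ?c"
  have XY: "?X \<noteq> 0" "?Y \<noteq> 0" using nonzero sum_nonzero by auto
  have O_nz: "(x * (x\<^sup>2 - S) * (y + z)\<^sup>2, y * (y\<^sup>2 - S) * (z + x)\<^sup>2, z * (z\<^sup>2 - S) * (x + y)\<^sup>2)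
      \<noteq> (0, 0, 0)"
    using nonzero sum_nonzero not_both_right by auto
  have O_A: "?a * (x * (x\<^sup>2 - S) * (y + z)\<^sup>2) + ?X * (y * (y\<^sup>2 - S) * (z + x)\<^sup>2)
      + (- ?X) * (z * (z\<^sup>2 - S) * (x + y)\<^sup>2) = 0"
    by (simp add: algebra_simps power2_eq_square)
  have O_B: "(- ?Y) * (x * (x\<^sup>2 - S) * (y + z)\<^sup>2) + ?b * (y * (y\<^sup>2 - S) * (z + x)\<^sup>2)
      + ?Y * (z * (z\<^sup>2 - S) * (x + y)\<^sup>2) = 0"
    by (simp add: algebra_simps power2_eq_square)
  have O_C: "?Z * (x * (x\<^sup>2 - S) * (y + z)\<^sup>2) + (- ?Z) * (y * (y\<^sup>2 - S) * (z + x)\<^sup>2)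
      + ?c * (z * (z\<^sup>2 - S) * (x + y)\<^sup>2) = 0"
    by (simp add: algebra_simps power2_eq_square)
  have cross: "(?X * ?Y - (- ?X) * ?b, (- ?X) * (- ?Y) - ?a * ?Y, ?a * ?b - ?X * (- ?Y)) \<noteq> (0, 0, 0)"
  proof
    assume *: "(?X * ?Y - (- ?X) * ?b, (- ?X) * (- ?Y) - ?a * ?Y, ?a * ?b - ?X * (- ?Y)) = (0, 0, 0)"
    have "?X * ?Y - (- ?X) * ?b = - 2 * ?X * z * (x\<^sup>2 - S)"
      by (simp add: algebra_simps power2_eq_square)
    moreover have "(- ?X) * (- ?Y) - ?a * ?Y = - 2 * ?Y * z * (y\<^sup>2 - S)"
      by (simp add: algebra_simps power2_eq_square)
    ultimately have "?X * z * (x\<^sup>2 - S) = 0" "?Y * z * (y\<^sup>2 - S) = 0"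
      using * by simp_all
    then have "x\<^sup>2 - S = 0" "y\<^sup>2 - S = 0" using XY nonzero by (metis mult_eq_0_iff)+
    then show False using CAB.not_both_right by simp
  qed
  have "Z \<in> ?A \<and> Z \<in> ?B \<and> Z \<in> ?C \<longleftrightarrow> Z = circumcenter" for Z
    using in_two_bary_lines_iff[OF cross O_nz O_A O_B, of Z] O_C O_nz
    by (auto simp only: barycentric_in_bary_line_iff[OF O_nz])
  then show ?thesis
    unfolding gen_circumcenter_def Let_def bisector b c common_point_def by simp
qed

lemma gen_isogonal_circumcenter:
  "gen_isogonal A B C P (gen_circumcenter A B C P) = gen_orthocenter A B C P"
proof -
  interpret BCA: triangle_point B C A y z x by (rule cyclic_point)
  interpret CAB: triangle_point C A B z x y by (rule BCA.cyclic_point)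
  have O: "BCA.circumcenter = circumcenter" "CAB.circumcenter = circumcenter"
    by (simp_all add: barycentric_def algebra_simps)
  (* The reflection at B is defined with the line DF; the cyclic shift of EF is FD. *)
  note a = line_reflected_circumcenter
  note b = BCA.line_reflected_circumcenter[unfolded P_cyclic isotomcomplement_cyclic O]
  note c = CAB.line_reflected_circumcenter[unfolded P_cyclic isotomcomplement_cyclic O]
  have D_F: "line (cevian_trace P A B C) (cevian_trace P C A B)
      = line (cevian_trace P C A B) (cevian_trace P A B C)"
    by (rule line_commute)
  show ?thesis
    unfolding gen_circumcenter_eq gen_isogonal_def gen_orthocenter_def Let_def D_F a b c ..
qed

end

theorem proposition3p9:
  fixes A B C :: "real^2" and P :: ext_point
  assumes "\<not> collinear {A, B, C}"
    and "P \<notin> sides A B C"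
    and "P \<notin> anticomplementary_sides A B C"
  shows "gen_isogonal A B C P (gen_circumcenter A B C P) = gen_orthocenter A B C P"
proof -
  interpret ABC: triangle A B C by standard fact
  interpret BCA: triangle B C A by (rule ABC.cyclic)
  interpret CAB: triangle C A B by (rule BCA.cyclic)
  obtain x y z where nz: "(x, y, z) \<noteq> (0, 0, 0)" and P: "P = barycentric A B C x y z"
    by (rule ABC.barycentric_cases)
  have "x \<noteq> 0" "y \<noteq> 0" "z \<noteq> 0"
    using assms(2) nz
    by (auto simp: P sides_def ABC.line_vertices ABC.barycentric_in_bary_line_iff)
  moreover have "anticomplementary_sides B C A = anticomplementary_sides A B C"
    "anticomplementary_sides C A B = anticomplementary_sides A B C"
    by (auto simp: anticomplementary_sides_def sides_def Let_def ABC.inv_complement_map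
        BCA.inv_complement_map CAB.inv_complement_map add_ac)
  then have "y + z \<noteq> 0" "z + x \<noteq> 0" "x + y \<noteq> 0"
    using assms(3) nz ABC.anticomplementary_side[of x y z] BCA.anticomplementary_side[of y z x]
      CAB.anticomplementary_side[of z x y]
    by (auto simp: P barycentric_cyclic[of A B C x y z] barycentric_cyclic[of B C A y z x])
  ultimately interpret triangle_point A B C x y z
    by unfold_locales
  show ?thesis
    unfolding P by (rule gen_isogonal_circumcenter)
qed

end
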